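(* For every integer $k\geq 29$ there exist infinitely many finite simple graphs $G$ such that $G$ has no $\{P_{2},P_{2k+1}\}$-factor and $$\sum_{0\leq j\leq k-1} c_{2j+1}(G-X)\leq \frac{32k+141}{72k-78}|X| \quad\text{for all } X\subseteq V(G).$$
   Context: For a graph $H$ and an integer $j\geq 1$, $c_{j}(H)$ denotes the number of connected components of $H$ having exactly $j$ vertices. $P_n$ denotes the path on $n$ vertices. A $\{P_2,P_{2k+1}\}$-factor of $G$ is a spanning subgraph of $G$ each of whose components is isomorphic to $P_2$ or to $P_{2k+1}$. *)

theory Defs
  imports Complex_Main
begin

definition simple_graph :: "nat set \<Rightarrow> nat set set \<Rightarrow> bool" where
  "simple_graph V E \<longleftrightarrow> finite V \<and>
     (\<forall>e\<in>E. \<exists>u v. e = {u, v} \<and> u \<noteq> v \<and> u \<in> V \<and> v \<in> V)"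

definition reachable :: "nat set \<Rightarrow> nat set set \<Rightarrow> nat \<Rightarrow> nat \<Rightarrow> bool" where
  "reachable V E u v \<longleftrightarrow> u \<in> V \<and> v \<in> V \<and>
     (u, v) \<in> {(x, y). {x, y} \<in> E \<and> x \<in> V \<and> y \<in> V}\<^sup>*"

definition components :: "nat set \<Rightarrow> nat set set \<Rightarrow> nat set set" where
  "components V E = {{v. reachable V E u v} | u. u \<in> V}"

definition del_verts :: "nat set \<Rightarrow> nat set set \<Rightarrow> nat set \<Rightarrow> nat set \<times> nat set set" where
  "del_verts V E X = (V - X, {e \<in> E. e \<subseteq> V - X})"

definition comp_count :: "nat \<Rightarrow> nat set \<Rightarrow> nat set set \<Rightarrow> nat" where
  "comp_count j V E = card {C \<in> components V E. card C = j}"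

definition is_path_graph :: "nat \<Rightarrow> nat set \<Rightarrow> nat set set \<Rightarrow> bool" where
  "is_path_graph n C F \<longleftrightarrow> (\<exists>xs. length xs = n \<and> distinct xs \<and> set xs = C \<and>
     F = {{xs ! i, xs ! (i + 1)} | i. i + 1 < n})"

definition has_P2_P2k1_factor :: "nat \<Rightarrow> nat set \<Rightarrow> nat set set \<Rightarrow> bool" where
  "has_P2_P2k1_factor k V E \<longleftrightarrow> (\<exists>F \<subseteq> E. \<forall>C \<in> components V F.
     is_path_graph 2 C {e \<in> F. e \<subseteq> C} \<or> is_path_graph (2 * k + 1) C {e \<in> F. e \<subseteq> C})"

end

theory Submission
  imports Defs
begin

text \<open>The ratio 4/9 is achieved already. On \<open>2k+3\<close> vertices take a core of 7 universal
  vertices and a large clique (the hub), and let 18 hub vertices \<open>3i\<close> carry a wing, that is, an edge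
  \<open>{3i+1, 3i+2}\<close> both ends of which are joined to \<open>3i\<close>. By parity a factor of this odd graph is one
  path on \<open>2k+1\<close> vertices and one edge, so the path visits at least 17 wings completely. Each of these
  contains an end of the path or is followed or preceded on it by a core vertex, so there
  are at most \<open>2 + 2 * 7 = 16\<close>, a contradiction.

  A set \<open>X\<close> not containing the core leaves one component here, which has fewer than \<open>2k\<close> vertices
  only if \<open>|X| \<ge> 3\<close>. Otherwise a wing becomes an odd component only if \<open>X\<close> contains \<open>3i\<close>
  and one end of the wing, so \<open>c\<close> odd wings give at most \<open>c + 1\<close> odd components at cost
  \<open>|X| \<ge> 7 + 2c\<close>, and \<open>9(c + 1) \<le> 4(7 + 2c)\<close> as \<open>c \<le> 18\<close>. A further large disjoint clique makes
  the order arbitrarily large.\<close>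

section \<open>Components\<close>

lemma reachable_sym:
  assumes "reachable V E u v"
  shows "reachable V E v u"
proof -
  let ?R = "{(x, y). {x, y} \<in> E \<and> x \<in> V \<and> y \<in> V}"
  have "sym ?R"
  proof (rule symI)
    fix x y assume "(x, y) \<in> ?R"
    then show "(y, x) \<in> ?R" by (simp add: insert_commute[of y x])
  qed
  then have sym: "sym (?R\<^sup>*)" by (rule sym_rtrancl)
  have uv: "u \<in> V" "v \<in> V" "(u, v) \<in> ?R\<^sup>*"
    using assms unfolding reachable_def by simp_all
  have "(v, u) \<in> ?R\<^sup>*" by (rule symD[OF sym uv(3)])
  then show ?thesis using uv unfolding reachable_def by simp
qed

lemma reachable_refl: "u \<in> V \<Longrightarrow> reachable V E u u"
  by (simp add: reachable_def)

lemma reachable_trans: "reachable V E u v \<Longrightarrow> reachable V E v w \<Longrightarrow> reachable V E u w"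
  unfolding reachable_def by (elim conjE, intro conjI) (assumption | rule rtrancl_trans)+

lemma component_eq:
  assumes "C \<in> components V E" "u \<in> C"
  shows "C = {v. reachable V E u v}"
proof -
  obtain w where w: "C = {v. reachable V E w v}" using assms(1) unfolding components_def by auto
  then have "reachable V E w u" using assms(2) by simp
  then have "reachable V E w v \<longleftrightarrow> reachable V E u v" for v
    using reachable_sym[of V E w u] reachable_trans[of V E w u v] reachable_trans[of V E u w v] by blast
  then show ?thesis by (simp add: w)
qed

lemma components_same:
  "C \<in> components V E \<Longrightarrow> D \<in> components V E \<Longrightarrow> u \<in> C \<Longrightarrow> u \<in> D \<Longrightarrow> C = D"
  by (rule trans[OF component_eq component_eq[symmetric]])

lemma component_subset: "C \<in> components V E \<Longrightarrow> C \<subseteq> V"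
  unfolding components_def reachable_def by blast

lemma component_nonempty: "C \<in> components V E \<Longrightarrow> C \<noteq> {}"
  unfolding components_def using reachable_refl[of _ V E] by blast

lemma component_exists: "u \<in> V \<Longrightarrow> \<exists>C \<in> components V E. u \<in> C"
  unfolding components_def using reachable_refl[of u V E] by blast

lemma component_adjacent:
  assumes "C \<in> components V E" "u \<in> C" "v \<in> V" "u = v \<or> {u, v} \<in> E"
  shows "v \<in> C"
proof -
  have "u \<in> V" using assms component_subset by blast
  then have "reachable V E u v"
    using assms(3,4) unfolding reachable_def by auto
  then show ?thesis using component_eq[OF assms(1,2)] by simp
qed

text \<open>Upper counterpart of \<open>component_adjacent\<close>: a set closed under edges cannot
  be left by a walk. The two together determine components without exhibiting walks.\<close>

lemma component_subset_closed:
  assumes "C \<in> components V E" "u \<in> C" "u \<in> S"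
    and "\<And>x y. x \<in> S \<Longrightarrow> x \<in> V \<Longrightarrow> y \<in> V \<Longrightarrow> {x, y} \<in> E \<Longrightarrow> y \<in> S"
  shows "C \<subseteq> S"
proof
  fix v assume "v \<in> C"
  then have "(u, v) \<in> {(x, y). {x, y} \<in> E \<and> x \<in> V \<and> y \<in> V}\<^sup>*"
    using component_eq[OF assms(1,2)] by (simp add: reachable_def)
  then show "v \<in> S"
    by (induction rule: rtrancl_induct) (use assms(3,4) in auto)
qed

lemma finite_components: "finite V \<Longrightarrow> finite (components V E)"
  by (simp add: components_def)

text \<open>The odd numbers below 2k are exactly 2j+1 with j < k, so the sum in the theorem becomes
  the size of a single set of components.\<close>

lemma sum_odd_comp_count:
  assumes "finite V"
  shows "(\<Sum>j<k. comp_count (2 * j + 1) V E)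
    = card {C \<in> components V E. odd (card C) \<and> card C < 2 * k}"
proof -
  have "{C \<in> components V E. odd (card C) \<and> card C < 2 * k}
      = (\<Union>j<k. {C \<in> components V E. card C = 2 * j + 1})"
    by (auto elim!: oddE)
  moreover have "card (\<Union>j<k. {C \<in> components V E. card C = 2 * j + 1})
      = (\<Sum>j<k. card {C \<in> components V E. card C = 2 * j + 1})"
    by (rule card_UN_disjoint) (use finite_components[OF assms] in auto)
  ultimately show ?thesis by (simp add: comp_count_def)
qed

section \<open>The construction\<close>

text \<open>The vertices of the disjoint clique, from \<open>2k+3\<close> on, also satisfy \<open>hub\<close>; the first conjunct
  of \<open>adj\<close> keeps them apart.\<close>

definition hub :: "nat \<Rightarrow> bool" where
  "hub v \<longleftrightarrow> 61 \<le> v \<or> v < 54 \<and> 3 dvd v"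

text \<open>The 18 triples {3i, 3i+1, 3i+2} fill the numbers below 54, and the core comes next. It
  fits below 2k+3 because 61 = 2 * 29 + 3.\<close>

definition core :: "nat set" where
  "core = {54..<61}"

definition adj :: "nat \<Rightarrow> nat \<Rightarrow> nat \<Rightarrow> bool" where
  "adj k u v \<longleftrightarrow> (u < 2 * k + 3 \<longleftrightarrow> v < 2 * k + 3) \<and>
     (u \<in> core \<or> v \<in> core \<or> hub u \<and> hub v \<or> u < 54 \<and> v < 54 \<and> u div 3 = v div 3)"

text \<open>4k+5+N splits as (2k+3) + (2k+2+N): the disjoint clique needs at least 2k+2 vertices, so
  that leaving a component with fewer than 2k costs three deletions.\<close>

definition verts :: "nat \<Rightarrow> nat \<Rightarrow> nat set" where
  "verts k N = {..<4 * k + 5 + N}"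

definition edges :: "nat \<Rightarrow> nat \<Rightarrow> nat set set" where
  "edges k N = {{u, v} | u v. u \<in> verts k N \<and> v \<in> verts k N \<and> u \<noteq> v \<and> adj k u v}"

lemma adj_sym: "adj k u v \<Longrightarrow> adj k v u"
  unfolding adj_def by metis

lemma edges_iff:
  "{u, v} \<in> edges k N \<longleftrightarrow> u \<in> verts k N \<and> v \<in> verts k N \<and> u \<noteq> v \<and> adj k u v"
  unfolding edges_def mem_Collect_eq doubleton_eq_iff using adj_sym by blast

lemma simple_graph_edges: "simple_graph (verts k N) (edges k N)"
  unfolding simple_graph_def edges_def by (auto simp: verts_def)

lemma vertex_cases:
  obtains "hub v" | "v \<in> core" | i where "i < 18" "v \<in> {3 * i + 1, 3 * i + 2}"
proof -
  consider "61 \<le> v" | "v \<in> core" | "v < 54" by (force simp: core_def)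
  then show ?thesis
  proof cases
    case 3
    then have i: "v div 3 < 18" by simp
    have "v mod 3 = 0 \<or> v \<in> {3 * (v div 3) + 1, 3 * (v div 3) + 2}"
      using div_mult_mod_eq[of v 3] mod_less_divisor[of 3 v] by (simp, linarith)
    then show ?thesis
    proof
      assume "v mod 3 = 0"
      then show ?thesis using that(1) 3 by (auto simp: hub_def)
    next
      assume "v \<in> {3 * (v div 3) + 1, 3 * (v div 3) + 2}"
      then show ?thesis using that(3) i by blast
    qed
  qed (use that in \<open>auto simp: hub_def\<close>)
qed

text \<open>A wing end is neither hub nor core, so outside the core only its own triple remains.
  Both the path argument and the component count rest on this.\<close>

lemma adj_wing:
  assumes "adj k u v" "u \<in> {3 * i + 1, 3 * i + 2}" "i < 18" "v \<notin> core"
  shows "v \<in> {3 * i, 3 * i + 1, 3 * i + 2}"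
proof -
  have "\<not> hub u" using assms by (auto simp: hub_def) presburger+
  moreover have "u \<notin> core" "u div 3 = i" using assms by (auto simp: core_def)
  ultimately have "v div 3 = i" using assms by (auto simp: adj_def)
  then show ?thesis by auto
qed

section \<open>No factor\<close>

text \<open>Each wing on the path has an end at a position of \<open>T\<close>, that is, at an end
  of the path or next to a core vertex. Otherwise the path neighbours of both wing ends would all
  lie in the triple, and the path would close up to a triangle.\<close>

lemma path_wings_bound:
  assumes dist: "distinct xs"
    and path: "\<And>t. t + 1 < length xs \<Longrightarrow> adj k (xs ! t) (xs ! (t + 1))"
    and I: "\<And>i. i \<in> I \<Longrightarrow> i < 18 \<and> {3 * i + 1, 3 * i + 2} \<subseteq> set xs"
  shows "card I \<le> 16"
proof -
  define P where "P = {t. t < length xs \<and> xs ! t \<in> core}"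
  \<comment> \<open>Truncated subtraction sends position 0 to 0, which is in \<open>T\<close>
    anyway.\<close>
  define T where "T = {0, length xs - 1} \<union> (\<lambda>t. t - 1) ` P \<union> Suc ` P"
  have finP: "finite P" by (simp add: P_def)
  have "card P \<le> card core"
    by (rule card_inj_on_le[where f = "(!) xs"])
      (use dist in \<open>auto simp: P_def core_def inj_on_def nth_eq_iff_index_eq\<close>)
  then have P7: "card P \<le> 7" by (simp add: core_def)
  have "card T \<le> card ({0, length xs - 1} \<union> (\<lambda>t. t - 1) ` P) + card (Suc ` P)"
    unfolding T_def by (rule card_Un_le)
  also have "\<dots> \<le> card {0, length xs - 1} + card ((\<lambda>t. t - 1) ` P) + card (Suc ` P)"
    by (intro add_right_mono card_Un_le)
  also have "\<dots> \<le> 2 + 7 + 7"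
    using P7 card_image_le[OF finP, of Suc] card_image_le[OF finP, of "\<lambda>t. t - 1"]
      card_insert_le_m1[of 2 "{length xs - 1}" 0]
    by (intro add_mono) auto
  finally have T16: "card T \<le> 16" by simp
  \<comment> \<open>Wing i is charged to a position of one of its ends; division by 3 recovers i, so
    \<open>T\<close> bounds the number of wings.\<close>
  have "I \<subseteq> (\<lambda>t. xs ! t div 3) ` T"
  proof
    fix i assume "i \<in> I"
    then have i: "i < 18" "{3 * i + 1, 3 * i + 2} \<subseteq> set xs" using I by auto
    obtain p where p: "p < length xs" "xs ! p = 3 * i + 1"
      using i by (auto simp: in_set_conv_nth)
    obtain q where q: "q < length xs" "xs ! q = 3 * i + 2"
      using i by (auto simp: in_set_conv_nth)
    have nb: "xs ! (t - 1) \<in> {3 * i, 3 * i + 1, 3 * i + 2} \<and> xs ! (t + 1) \<in> {3 * i, 3 * i + 1, 3 * i + 2}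
        \<and> 0 < t \<and> t + 1 < length xs"
      if t: "t < length xs" "xs ! t \<in> {3 * i + 1, 3 * i + 2}" "t \<notin> T" for t
    proof -
      have t1: "0 < t" "t + 1 < length xs" using t by (auto simp: T_def)
      have "t + 1 \<notin> P" "t - 1 \<notin> P" using t t1 unfolding T_def by force+
      then have "xs ! (t + 1) \<notin> core" "xs ! (t - 1) \<notin> core" using t1 by (auto simp: P_def)
      moreover have "adj k (xs ! t) (xs ! (t + 1))" using path t1 by simp
      moreover have "adj k (xs ! t) (xs ! (t - 1))" using path[of "t - 1"] t1 adj_sym by simp
      ultimately show ?thesis using adj_wing t(2) i(1) t1 by blast
    qed
    have "p \<in> T \<or> q \<in> T"
    proof (rule ccontr)
      assume "\<not> (p \<in> T \<or> q \<in> T)"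
      then have P: "xs ! (p - 1) \<in> {3 * i, 3 * i + 1, 3 * i + 2}"
          "xs ! (p + 1) \<in> {3 * i, 3 * i + 1, 3 * i + 2}" "0 < p" "p + 1 < length xs"
        and Q: "xs ! (q - 1) \<in> {3 * i, 3 * i + 1, 3 * i + 2}"
          "xs ! (q + 1) \<in> {3 * i, 3 * i + 1, 3 * i + 2}" "0 < q" "q + 1 < length xs"
        using nb[of p] nb[of q] p q by auto
      have inj: "s = t" if "xs ! s = xs ! t" "s < length xs" "t < length xs" for s t
        using that dist by (simp add: nth_eq_iff_index_eq)
      \<comment> \<open>With b the value at the current position, its two path neighbours must be
        the other two members of the triple.\<close>
      have pick: "x = c \<and> y = a \<or> y = c \<and> x = a"
        if "x \<in> {a, b, c}" "y \<in> {a, b, c}" "x \<noteq> b" "y \<noteq> b" "x \<noteq> y" for x y a b c :: nat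
        using that by blast
      have "xs ! (p - 1) \<noteq> xs ! p" "xs ! (p + 1) \<noteq> xs ! p" "xs ! (p - 1) \<noteq> xs ! (p + 1)"
        "xs ! (q - 1) \<noteq> xs ! q" "xs ! (q + 1) \<noteq> xs ! q" "xs ! (q - 1) \<noteq> xs ! (q + 1)"
        using P(3,4) Q(3,4) by (simp_all add: nth_eq_iff_index_eq[OF dist])
      then have "xs ! (p - 1) = xs ! q \<and> xs ! (p + 1) = 3 * i \<or> xs ! (p + 1) = xs ! q \<and> xs ! (p - 1) = 3 * i"
        and "xs ! (q - 1) = xs ! p \<and> xs ! (q + 1) = 3 * i \<or> xs ! (q + 1) = xs ! p \<and> xs ! (q - 1) = 3 * i"
        using pick[OF P(1,2)] pick[OF Q(1,2)[unfolded insert_commute[of "3 * i + 1" "3 * i + 2"]]]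
        unfolding p(2) q(2) by blast+
      \<comment> \<open>The wing ends are consecutive on the path, and on the far side of each
        stands 3i. It would occur at two different positions.\<close>
      then have "p - 1 = q \<and> xs ! (p + 1) = 3 * i \<or> p + 1 = q \<and> xs ! (p - 1) = 3 * i"
        and "q - 1 = p \<and> xs ! (q + 1) = 3 * i \<or> q + 1 = p \<and> xs ! (q - 1) = 3 * i"
        using inj[of "p - 1" q] inj[of "p + 1" q] inj[of "q - 1" p] inj[of "q + 1" p] P(3,4) Q(3,4)
        by (meson less_imp_diff_less add_lessD1)+
      moreover have "xs ! (p + 1) = xs ! (q - 1) \<Longrightarrow> p + 1 = q - 1"
        using inj[of "p + 1" "q - 1"] P(4) Q(4) by linarith
      moreover have "xs ! (p - 1) = xs ! (q + 1) \<Longrightarrow> p - 1 = q + 1"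
        using inj[of "p - 1" "q + 1"] P(4) Q(4) by linarith
      ultimately show False using P(3) Q(3) by (elim disjE) auto
    qed
    then show "i \<in> (\<lambda>t. xs ! t div 3) ` T"
    proof
      assume "p \<in> T" then show ?thesis using p(2) by (intro image_eqI[of _ _ p]) auto
    next
      assume "q \<in> T" then show ?thesis using q(2) by (intro image_eqI[of _ _ q]) auto
    qed
  qed
  moreover have "finite T" using finP by (simp add: T_def)
  ultimately show ?thesis using T16 surj_card_le le_trans by blast
qed

lemma no_factor:
  assumes k: "k \<ge> 29"
  shows "\<not> has_P2_P2k1_factor k (verts k N) (edges k N)"
proof
  let ?V = "verts k N"
  assume "has_P2_P2k1_factor k ?V (edges k N)"
  then obtain F where F: "F \<subseteq> edges k N"
    and path: "\<And>C. C \<in> components ?V F \<Longrightarrow>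
      is_path_graph 2 C {e \<in> F. e \<subseteq> C} \<or> is_path_graph (2 * k + 1) C {e \<in> F. e \<subseteq> C}"
    unfolding has_P2_P2k1_factor_def by blast
  let ?A = "{..<2 * k + 3}"
  have AV: "?A \<subseteq> ?V" by (auto simp: verts_def)
  have inA: "C \<subseteq> ?A" if C: "C \<in> components ?V F" "C \<inter> ?A \<noteq> {}" for C
  proof -
    obtain u where "u \<in> C" "u \<in> ?A" using C by blast
    then show ?thesis
    proof (rule component_subset_closed[OF C(1)])
      fix x y assume "x \<in> ?A" "{x, y} \<in> F"
      then show "y \<in> ?A" using F edges_iff[of x y k N] by (auto simp: adj_def)
    qed
  qed
  have card_path: "card C = m" if "is_path_graph m C D" for m C D
    using that by (auto simp: is_path_graph_def distinct_card)
  \<comment> \<open>As no edge leaves the first 2k+3 vertices, these components partition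
    them.\<close>
  define CA where "CA = {C \<in> components ?V F. C \<subseteq> ?A}"
  have UnCA: "\<Union>CA = ?A"
  proof
    show "?A \<subseteq> \<Union>CA"
    proof
      fix u assume u: "u \<in> ?A"
      then obtain C where "C \<in> components ?V F" "u \<in> C" using component_exists AV by blast
      then show "u \<in> \<Union>CA" using inA u unfolding CA_def by blast
    qed
  qed (auto simp: CA_def)
  \<comment> \<open>Parity: components of size 2 alone would make 2k+3 even.\<close>
  have "\<exists>C \<in> CA. card C \<noteq> 2"
  proof (rule ccontr)
    assume *: "\<not> ?thesis"
    have "card (\<Union>CA) = (\<Sum>C\<in>CA. card C)"
    proof (rule card_Union_disjoint)
      show "pairwise disjnt CA"
        unfolding pairwise_def disjnt_def CA_def using components_same by blast
      show "finite C" if "C \<in> CA" for C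
        using that finite_subset[of C ?A] by (simp add: CA_def)
    qed
    also have "\<dots> = 2 * card CA" using * by simp
    finally show False using UnCA by (simp, presburger)
  qed
  then obtain C where C: "C \<in> components ?V F" "C \<subseteq> ?A" "card C \<noteq> 2" by (auto simp: CA_def)
  then have "is_path_graph (2 * k + 1) C {e \<in> F. e \<subseteq> C}" using path card_path by blast
  then obtain xs where xs: "length xs = 2 * k + 1" "distinct xs" "set xs = C"
    "{e \<in> F. e \<subseteq> C} = {{xs ! i, xs ! (i + 1)} | i. i + 1 < 2 * k + 1}"
    unfolding is_path_graph_def by blast
  have xs_adj: "adj k (xs ! t) (xs ! (t + 1))" if "t + 1 < length xs" for t
  proof -
    have "{xs ! t, xs ! (t + 1)} \<in> {e \<in> F. e \<subseteq> C}"
      unfolding xs(4) using that unfolding xs(1) by blast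
    then show ?thesis using F edges_iff by blast
  qed
  have finC: "finite C" using xs(3) by auto
  have "card (?A - C) = 2"
    using C(2) xs(1-3) finC distinct_card[of xs] by (simp add: card_Diff_subset)
  then obtain u where u: "u \<in> ?A - C"
    by (metis card.empty ex_in_conv zero_neq_numeral)
  then obtain D where D: "D \<in> components ?V F" "u \<in> D" using component_exists AV by blast
  \<comment> \<open>The component of a leftover vertex lies among the two leftover vertices, too few
    for the long path; it is therefore an edge and uses up both.\<close>
  have DA: "D \<subseteq> ?A - C"
    using components_same[OF D(1) C(1)] u D inA[OF D(1)] by blast
  then have "card D \<le> 2" using card_mono[of "?A - C" D] \<open>card (?A - C) = 2\<close> by simp
  then have D2: "is_path_graph 2 D {e \<in> F. e \<subseteq> D}"
    using path[OF D(1)] card_path k by fastforce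
  then have D_eq: "D = ?A - C"
    using card_path[OF D2] DA \<open>card (?A - C) = 2\<close> by (intro card_subset_eq) auto
  obtain ys where ys: "length ys = 2" "set ys = D"
    "{e \<in> F. e \<subseteq> D} = {{ys ! i, ys ! (i + 1)} | i. i + 1 < 2}"
    using D2 unfolding is_path_graph_def by blast
  define v w where "v = ys ! 0" and "w = ys ! 1"
  have "{v, w} \<in> {e \<in> F. e \<subseteq> D}" unfolding ys(3) v_def w_def by force
  then have "adj k v w" using F edges_iff by blast
  have Dvw: "D = {v, w}"
    using ys(1,2) by (auto simp: v_def w_def length_Suc_conv numeral_2_eq_2)
  define J where "J = {i. i < 18 \<and> {3 * i + 1, 3 * i + 2} \<inter> D \<noteq> {}}"
  \<comment> \<open>If the leftover edge joins ends of two wings, \<open>adj_wing\<close> puts them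
    in the same triple.\<close>
  have "i = j" if "i \<in> J" "j \<in> J" for i j
  proof -
    have aux: "i = j" if "v \<in> {3 * i + 1, 3 * i + 2}" "w \<in> {3 * j + 1, 3 * j + 2}" "i < 18" "j < 18"
      for i j
      using adj_wing[OF \<open>adj k v w\<close> that(1,3)] that by (auto simp: core_def)
    have same: "i = j" if "z \<in> {3 * i + 1, 3 * i + 2}" "z \<in> {3 * j + 1, 3 * j + 2}" for i j z :: nat
      using that by auto
    show ?thesis using that aux same unfolding J_def Dvw by blast
  qed
  then have "card J \<le> 1" using card_le_Suc0_iff_eq[of J] by (simp add: J_def)
  \<comment> \<open>Wings missed by the leftover edge lie entirely on the path; but 18 exceeds 16 +
    1.\<close>
  moreover have "card ({..<18} - J) \<le> 16"
  proof (rule path_wings_bound[OF xs(2) xs_adj])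
    fix i assume i: "i \<in> {..<18} - J"
    then have "{3 * i + 1, 3 * i + 2} \<subseteq> ?A" using k by auto
    then show "i < 18 \<and> {3 * i + 1, 3 * i + 2} \<subseteq> set xs"
      using i unfolding xs(3) J_def D_eq by blast
  qed
  moreover have "card {..<18::nat} \<le> card ({..<18} - J) + card J"
    using diff_card_le_card_Diff[of J "{..<18}"] by (simp add: J_def)
  ultimately show False by simp
qed

section \<open>Counting small odd components\<close>

text \<open>No component meets both parts of the graph, so the bound is proved for each part against
  its share of \<open>X\<close> and the two are added.\<close>

lemma small_odd_components_bound:
  assumes k: "k \<ge> 29" and X: "X \<subseteq> verts k N"
  shows "9 * card {C \<in> components (verts k N - X) {e \<in> edges k N. e \<subseteq> verts k N - X}.
      odd (card C) \<and> card C < 2 * k} \<le> 4 * card X"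
proof -
  let ?V = "verts k N - X"
  let ?E = "{e \<in> edges k N. e \<subseteq> ?V}"
  let ?A = "{..<2 * k + 3}"
  let ?B = "{2 * k + 3..<4 * k + 5 + N}"
  define S where "S = {C \<in> components ?V ?E. odd (card C) \<and> card C < 2 * k}"
  have finV: "finite ?V" by (simp add: verts_def)
  have finS: "finite S" using finite_components[OF finV] by (simp add: S_def)
  have V_eq: "verts k N = ?A \<union> ?B" by (auto simp: verts_def)
  have E_iff: "{u, v} \<in> ?E \<longleftrightarrow> u \<in> ?V \<and> v \<in> ?V \<and> u \<noteq> v \<and> adj k u v" for u v
    using edges_iff[of u v k N] by auto
  have S_comp: "C \<in> components ?V ?E" if "C \<in> S" for C using that by (simp add: S_def)
  have S_fin: "finite C" if "C \<in> S" for C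
    using component_subset[OF S_comp[OF that]] finV finite_subset by blast
  have S_adj: "v \<in> C" if "C \<in> S" "u \<in> C" "v \<in> ?V" "adj k u v" for C u v
    using component_adjacent[OF S_comp[OF that(1)] that(2,3)] that(3,4) E_iff
      component_subset[OF S_comp[OF that(1)]] that(2) by blast
  have S_same: "C = D" if "C \<in> S" "D \<in> S" "u \<in> C" "u \<in> D" for C D u
    using components_same S_comp that by blast
  \<comment> \<open>A component in \<open>S\<close> has at most 2k-1 vertices, so at least three of
    the 2k+2 or more vertices of \<open>Y\<close> are deleted. This pays for one component, since 9
    \<le> 4 * 3.\<close>
  have big: "3 \<le> card (X \<inter> Y)" if "C \<in> S" "Y - X \<subseteq> C" "finite Y" "2 * k + 2 \<le> card Y" for C Y
  proof -
    have "card (Y - X) \<le> card C" using that S_fin card_mono by blast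
    moreover have "card C < 2 * k" using that by (simp add: S_def)
    moreover have "card (Y - X) = card Y - card (X \<inter> Y)"
      using that by (metis Int_commute card_Diff_subset_Int finite_Int)
    ultimately show ?thesis using \<open>2 * k + 2 \<le> card Y\<close> \<open>C \<in> S\<close> by (auto simp: S_def)
  qed
  define SB where "SB = {C \<in> S. C \<inter> ?B \<noteq> {}}"
  define SA where "SA = {C \<in> S. C \<inter> ?A \<noteq> {}}"
  have S_un: "S = SB \<union> SA"
    using component_nonempty component_subset S_comp V_eq unfolding SA_def SB_def by blast
  have B_sub: "?B - X \<subseteq> C" if "C \<in> SB" for C
  proof
    fix v assume v: "v \<in> ?B - X"
    obtain u where "u \<in> C" "u \<in> ?B" using \<open>C \<in> SB\<close> unfolding SB_def by blast
    moreover have "adj k u v" using v \<open>u \<in> ?B\<close> k by (auto simp: adj_def hub_def)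
    ultimately show "v \<in> C" using S_adj that v V_eq by (auto simp: SB_def)
  qed
  have SB: "9 * card SB \<le> 4 * card (X \<inter> ?B)"
  proof (cases "SB = {}")
    case False
    then obtain C where C: "C \<in> SB" by blast
    have "D = C" if "D \<in> SB" for D
    proof -
      obtain u where u: "u \<in> C" "u \<in> ?B" using C unfolding SB_def by blast
      have "u \<in> ?V" using component_subset S_comp u(1) C unfolding SB_def by blast
      then have "u \<in> D" using B_sub[OF that] u by blast
      then show "D = C" using S_same u C that by (auto simp: SB_def)
    qed
    then have "SB = {C}" using C by blast
    moreover have "3 \<le> card (X \<inter> ?B)"
      by (rule big[OF _ B_sub[OF C]]) (use C in \<open>auto simp: SB_def\<close>)
    ultimately show ?thesis by simp
  qed simp
  have SA: "9 * card SA \<le> 4 * card (X \<inter> ?A)"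
  proof (cases "core \<subseteq> X")
    case False
    then obtain z where z: "z \<in> core" "z \<notin> X" by blast
    then have zA: "z \<in> ?A" using k by (auto simp: core_def)
    then have zV: "z \<in> ?V" using z V_eq by blast
    \<comment> \<open>A surviving core vertex sees all of \<open>?A\<close>, so there is at most one
      component here and \<open>big\<close> applies to it.\<close>
    have zC: "z \<in> C" if "C \<in> SA" for C
    proof -
      obtain u where "u \<in> C" "u \<in> ?A" using \<open>C \<in> SA\<close> unfolding SA_def by blast
      moreover have "adj k u z" using z(1) zA \<open>u \<in> ?A\<close> by (auto simp: adj_def)
      ultimately show "z \<in> C" using S_adj \<open>C \<in> SA\<close> zV by (auto simp: SA_def)
    qed
    show ?thesis
    proof (cases "SA = {}")
      case False
      then obtain C where C: "C \<in> SA" by blast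
      have "SA = {C}" using C zC S_same unfolding SA_def by blast
      moreover have "?A - X \<subseteq> C"
      proof
        fix v assume v: "v \<in> ?A - X"
        then have "adj k z v" using z zA by (auto simp: adj_def)
        then show "v \<in> C" using S_adj[of C z v] C zC[OF C] v V_eq by (auto simp: SA_def)
      qed
      then have "3 \<le> card (X \<inter> ?A)"
        by (rule big[rotated]) (use C in \<open>auto simp: SA_def\<close>)
      ultimately show ?thesis by simp
    qed simp
  next
    case True
    \<comment> \<open>The surviving hub vertices of \<open>?A\<close> form a clique, so
      \<open>H\<close> has at most one member. Every other component in \<open>SA\<close> is charged
      to a triple with two deleted vertices.\<close>
    define H where "H = {C \<in> SA. \<exists>u \<in> C. hub u \<and> u \<in> ?A}"
    define J where "J = {i. i < 18 \<and> 2 \<le> card (X \<inter> {3 * i, 3 * i + 1, 3 * i + 2})}"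
    have finJ: "finite J" by (simp add: J_def)
    have "C = D" if CD: "C \<in> H" "D \<in> H" for C D
    proof -
      obtain u v where uv: "u \<in> C" "v \<in> D" "hub u" "hub v" "u \<in> ?A" "v \<in> ?A"
        using CD by (auto simp: H_def)
      then have "adj k u v" by (auto simp: adj_def)
      moreover have "v \<in> ?V" using CD component_subset S_comp uv(2) unfolding H_def SA_def by blast
      ultimately have "v \<in> C" using S_adj uv CD by (auto simp: H_def SA_def)
      then show "C = D" using S_same uv CD by (auto simp: H_def SA_def)
    qed
    moreover have finSA: "finite SA" using finS by (simp add: SA_def)
    ultimately have H1: "card H \<le> 1" using card_le_Suc0_iff_eq[of H] by (simp add: H_def)
    have "SA - H \<subseteq> (\<lambda>i. {3 * i, 3 * i + 1, 3 * i + 2} - X) ` J"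
    proof
      fix C assume C: "C \<in> SA - H"
      then have CS: "C \<in> S" by (simp add: SA_def)
      have CV: "C \<subseteq> ?V" using component_subset S_comp CS by blast
      obtain u where u: "u \<in> C" "u \<in> ?A" using C unfolding SA_def by blast
      have "\<not> hub u" using C u by (auto simp: H_def)
      moreover have "u \<notin> core" using True CV u by blast
      ultimately obtain i where i: "i < 18" "u \<in> {3 * i + 1, 3 * i + 2}"
        using vertex_cases[of u] by metis
      let ?T = "{3 * i, 3 * i + 1, 3 * i + 2}"
      have TA: "?T \<subseteq> ?A" using i k by auto
      have T_adj: "adj k x y" if "x \<in> ?T" "y \<in> ?T" for x y
      proof -
        have "x div 3 = i" "y div 3 = i" using that by auto
        moreover have "x < 54" "y < 54" using that i(1) by auto
        moreover have "x < 2 * k + 3" "y < 2 * k + 3" using that TA by blast+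
        ultimately show ?thesis by (simp add: adj_def)
      qed
      \<comment> \<open>An undeleted 3i would be joined to \<open>u\<close> and put \<open>C\<close>
        into \<open>H\<close>.\<close>
      have y: "3 * i \<in> X"
      proof (rule ccontr)
        assume "3 * i \<notin> X"
        then have "3 * i \<in> C"
          using S_adj[OF CS u(1), of "3 * i"] T_adj[of u "3 * i"] i TA V_eq by auto
        moreover have "hub (3 * i)" using i by (simp add: hub_def)
        ultimately show False using C TA by (auto simp: H_def)
      qed
      have "C \<subseteq> {3 * i + 1, 3 * i + 2}"
      proof (rule component_subset_closed[OF S_comp[OF CS] u(1) i(2)])
        fix v w assume vw: "v \<in> {3 * i + 1, 3 * i + 2}" "w \<in> ?V" "{v, w} \<in> ?E"
        then have "adj k v w" using E_iff by blast
        moreover have "w \<notin> core" using True vw by blast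
        ultimately have "w \<in> ?T" using adj_wing vw(1) i(1) by blast
        then show "w \<in> {3 * i + 1, 3 * i + 2}" using y vw(2) by blast
      qed
      moreover have "?T - X \<subseteq> C"
      proof
        fix w assume "w \<in> ?T - X"
        then show "w \<in> C" using S_adj[OF CS u(1), of w] T_adj[of u w] i TA V_eq by auto
      qed
      ultimately have C_eq: "C = ?T - X" using CV y by blast
      have "odd (card C)" using CS by (simp add: S_def)
      \<comment> \<open>An intact wing has two vertices, so oddness forces the deletion of one of
        its ends besides 3i.\<close>
      then have "C \<noteq> {3 * i + 1, 3 * i + 2}" by auto
      then obtain w where "w \<in> {3 * i + 1, 3 * i + 2}" "w \<in> X" using C_eq y by auto
      then have "{3 * i, w} \<subseteq> X \<inter> ?T" "card {3 * i, w} = 2" using y by auto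
      then have "2 \<le> card (X \<inter> ?T)" by (metis card_mono finite.emptyI finite.insertI finite_Int)
      then show "C \<in> (\<lambda>i. {3 * i, 3 * i + 1, 3 * i + 2} - X) ` J"
        using C_eq i by (auto simp: J_def)
    qed
    then have "card (SA - H) \<le> card J" using finJ surj_card_le by blast
    then have "card SA \<le> card J + 1"
      using H1 diff_card_le_card_Diff[of H SA] finSA by (simp add: H_def)
    moreover have "card J \<le> 18" using card_mono[of "{..<18}" J] by (auto simp: J_def)
    \<comment> \<open>The core and the triples are pairwise disjoint, so their deletions add
      up.\<close>
    moreover have "7 + 2 * card J \<le> card (X \<inter> ?A)"
    proof -
      let ?U = "\<Union>i\<in>J. X \<inter> {3 * i, 3 * i + 1, 3 * i + 2}"
      have "2 * card J \<le> (\<Sum>i\<in>J. card (X \<inter> {3 * i, 3 * i + 1, 3 * i + 2}))"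
        using sum_bounded_below[of J 2 "\<lambda>i. card (X \<inter> {3 * i, 3 * i + 1, 3 * i + 2})"]
        by (simp add: J_def mult.commute)
      also have "\<dots> = card ?U"
      proof (rule card_UN_disjoint[symmetric])
        have block: "z div 3 = i" if "z \<in> {3 * i, 3 * i + 1, 3 * i + 2}" for z i :: nat
          using that by auto
        show "\<forall>i\<in>J. \<forall>j\<in>J. i \<noteq> j \<longrightarrow> X \<inter> {3 * i, 3 * i + 1, 3 * i + 2}
            \<inter> (X \<inter> {3 * j, 3 * j + 1, 3 * j + 2}) = {}"
        proof (intro ballI impI equals0I)
          fix i j z
          assume "i \<noteq> j" and z: "z \<in> X \<inter> {3 * i, 3 * i + 1, 3 * i + 2} \<inter> (X \<inter> {3 * j, 3 * j + 1, 3 * j + 2})"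
          have "z div 3 = i" by (rule block) (use z in \<open>elim IntE\<close>)
          moreover have "z div 3 = j" by (rule block) (use z in \<open>elim IntE\<close>)
          ultimately show False using \<open>i \<noteq> j\<close> by simp
        qed
      qed (use finJ in auto)
      finally have "7 + 2 * card J \<le> card core + card ?U" by (simp add: core_def)
      also have "\<dots> = card (core \<union> ?U)"
        using finJ by (intro card_Un_disjoint[symmetric]) (auto simp: core_def J_def)
      also have "\<dots> \<le> card (X \<inter> ?A)"
        by (rule card_mono) (use True k in \<open>auto simp: core_def J_def\<close>)
      finally show ?thesis .
    qed
    \<comment> \<open>With c = \<open>card J\<close>, the inequality 9(c+1) \<le> 4(7+2c) says c
      \<le> 19.\<close>
    ultimately show ?thesis by linarith
  qed
  have "card S \<le> card SB + card SA" unfolding S_un by (rule card_Un_le)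
  moreover have "card X = card (X \<inter> ?B) + card (X \<inter> ?A)"
  proof -
    have "X = (X \<inter> ?B) \<union> (X \<inter> ?A)" using X V_eq by blast
    moreover have "card ((X \<inter> ?B) \<union> (X \<inter> ?A)) = card (X \<inter> ?B) + card (X \<inter> ?A)"
      by (rule card_Un_disjoint) auto
    ultimately show ?thesis by simp
  qed
  ultimately show ?thesis using SA SB unfolding S_def by linarith
qed

text \<open>Infinitude is expressed by unbounded order, which yields infinitely many graphs even up
  to isomorphism.\<close>

theorem theorem2:
  fixes k :: nat
  assumes "k \<ge> 29"
  shows "\<forall>N. \<exists>V E. card V \<ge> N \<and> simple_graph V E \<and> \<not> has_P2_P2k1_factor k V E \<and>
     (\<forall>X \<subseteq> V. real (\<Sum>j<k. comp_count (2 * j + 1) (fst (del_verts V E X)) (snd (del_verts V E X)))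
        \<le> (32 * real k + 141) / (72 * real k - 78) * real (card X))"
proof
  fix N
  \<comment> \<open>The denominator is positive, and after cross-multiplication 288k cancels,
    leaving -312 \<le> 1269.\<close>
  have ratio: "4 / 9 \<le> (32 * real k + 141) / (72 * real k - 78)"
    using assms by (simp add: field_simps)
  have "real (\<Sum>j<k. comp_count (2 * j + 1) (fst (del_verts (verts k N) (edges k N) X))
        (snd (del_verts (verts k N) (edges k N) X)))
      \<le> (32 * real k + 141) / (72 * real k - 78) * real (card X)" (is "real ?c \<le> _")
    if X: "X \<subseteq> verts k N" for X
  proof -
    have "finite (verts k N - X)" by (simp add: verts_def)
    then have "9 * ?c \<le> 4 * card X"
      using small_odd_components_bound[OF assms X] sum_odd_comp_count[of "verts k N - X" "{e \<in> edges k N. e \<subseteq> verts k N - X}" k]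
      by (simp add: del_verts_def)
    then have "real ?c \<le> 4 / 9 * real (card X)" by linarith
    also have "\<dots> \<le> (32 * real k + 141) / (72 * real k - 78) * real (card X)"
      using ratio by (intro mult_right_mono) auto
    finally show ?thesis .
  qed
  then show "\<exists>V E. card V \<ge> N \<and> simple_graph V E \<and> \<not> has_P2_P2k1_factor k V E \<and>
     (\<forall>X \<subseteq> V. real (\<Sum>j<k. comp_count (2 * j + 1) (fst (del_verts V E X)) (snd (del_verts V E X)))
        \<le> (32 * real k + 141) / (72 * real k - 78) * real (card X))"
    using simple_graph_edges no_factor[OF assms]
    by (intro exI[of _ "verts k N"] exI[of _ "edges k N"]) (auto simp: verts_def)
qed

end
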